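(* The elementary cellular automata with Wolfram codes $15$ and $170$, for both asynchronous dynamics (the partially asynchronous dynamic with update rate $0<\alpha\le 1$ and the fully asynchronous dynamic), either coalesce or end in total disagreement, each case with probability $\frac12$ (with respect to the outcome of the initial configuration and of the update sequence $(M_t)$).
   Context: An elementary cellular automaton (ECA) has cell space $\mathcal{U}=\mathbb{Z}/n\mathbb{Z}$ (size $n$, periodic boundary), states $\{0,1\}$, and a rule $\delta:\{0,1\}^3\to\{0,1\}$ applied to (left neighbor, cell itself, right neighbor). Its Wolfram code is $2^7\delta(1,1,1)+2^6\delta(1,1,0)+2^5\delta(1,0,1)+2^4\delta(1,0,0)+2^3\delta(0,1,1)+2^2\delta(0,1,0)+2\,\delta(0,0,1)+\delta(0,0,0)$. Asynchronous evolution: let $(M_t)_{t\in\mathbb{N}}$ be i.i.d. random elements of $\{0,1\}^{\mathcal{U}}$. Given $c_0:\mathcal{U}\to\{0,1\}$, set $c_{t+1}(z)=c_t(z)$ if $M_t(z)=0$ and $c_{t+1}(z)=\delta(c_t(z-1),c_t(z),c_t(z+1))$ if $M_t(z)=1$. Partially asynchronous dynamic with rate $\alpha$, $0<\alpha\le 1$: each cell is updated with probability $\alpha$ independently of the others, i.e. the coordinates of $M_t$ are independent Bernoulli($\alpha$); $\alpha=1$ is the synchronous dynamic. Fully asynchronous dynamic: at each step one uniformly chosen cell is updated, i.e. $M_t$ has exactly one coordinate equal to $1$, at a uniformly random cell. Two copies of the automaton are run from two (random) initial configurations with the same update sequence $(M_t)$. To coalesce means that the two configurations become identical, within polynomial expected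 time with respect to $n$. Total disagreement means that the two configurations differ at every cell of $\mathcal{U}$.
   Formalization: The update rate is restricted to 0<α<1: at α=1 (synchronous) the disagreement pattern only rotates, so for n≥2 each outcome has probability 2^{-n}, not 1/2, and the claim fails. *)

theory Defs
  imports "HOL-Probability.Probability" "HOL-Computational_Algebra.Polynomial"
begin

text \<open>The cell space \<open>\<int>/n\<int>\<close> is represented by the residues \<open>0, \<dots>, n - 1\<close>. Configurations and
  update masks are functions on all of \<open>int\<close>; only their values on \<open>cells n\<close> are meaningful,
  and the distributions below produce functions that are \<open>False\<close> elsewhere.\<close>

definition cells :: "nat \<Rightarrow> int set" where
  "cells n = {0..<int n}"

type_synonym config = "int \<Rightarrow> bool"

text \<open>A local rule takes the left neighbour, the cell itself and the right neighbour, in this order.\<close>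

type_synonym rule = "bool \<Rightarrow> bool \<Rightarrow> bool \<Rightarrow> bool"

definition wolfram_code :: "rule \<Rightarrow> nat" where
  "wolfram_code \<delta> =
     2 ^ 7 * of_bool (\<delta> True True True) + 2 ^ 6 * of_bool (\<delta> True True False) +
     2 ^ 5 * of_bool (\<delta> True False True) + 2 ^ 4 * of_bool (\<delta> True False False) +
     2 ^ 3 * of_bool (\<delta> False True True) + 2 ^ 2 * of_bool (\<delta> False True False) +
     2 * of_bool (\<delta> False False True) + of_bool (\<delta> False False False)"

definition step :: "rule \<Rightarrow> nat \<Rightarrow> config \<Rightarrow> config \<Rightarrow> config" where
  "step \<delta> n m c = (\<lambda>z. if z \<in> cells n \<and> m z
     then \<delta> (c ((z - 1) mod int n)) (c z) (c ((z + 1) mod int n)) else c z)"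

primrec evolve :: "rule \<Rightarrow> nat \<Rightarrow> config \<Rightarrow> config stream \<Rightarrow> nat \<Rightarrow> config" where
  "evolve \<delta> n c M 0 = c"
| "evolve \<delta> n c M (Suc t) = step \<delta> n (M !! t) (evolve \<delta> n c M t)"

text \<open>The laws of a single update mask, as functions of the size \<open>n\<close>.\<close>

definition partially_asynchronous :: "real \<Rightarrow> nat \<Rightarrow> config pmf" where
  "partially_asynchronous \<alpha> n = Pi_pmf (cells n) False (\<lambda>_. bernoulli_pmf \<alpha>)"

definition fully_asynchronous :: "nat \<Rightarrow> config pmf" where
  "fully_asynchronous n = map_pmf (\<lambda>z z'. z' = z) (pmf_of_set (cells n))"

definition uniform_config :: "nat \<Rightarrow> config pmf" where
  "uniform_config n = pmf_of_set {c. \<forall>z. z \<notin> cells n \<longrightarrow> \<not> c z}"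

text \<open>Outcomes consist of two independent uniform initial configurations and, independently of
  them, an i.i.d. sequence of update masks, shared by the two copies.\<close>

type_synonym outcome = "(config \<times> config) \<times> config stream"

definition coupling_space :: "(nat \<Rightarrow> config pmf) \<Rightarrow> nat \<Rightarrow> outcome measure" where
  "coupling_space D n =
     measure_pmf (pair_pmf (uniform_config n) (uniform_config n))
       \<Otimes>\<^sub>M stream_space (measure_pmf (D n))"

fun identical_at :: "rule \<Rightarrow> nat \<Rightarrow> outcome \<Rightarrow> nat \<Rightarrow> bool" where
  "identical_at \<delta> n ((c, c'), M) t \<longleftrightarrow>
     (\<forall>z \<in> cells n. evolve \<delta> n c M t z = evolve \<delta> n c' M t z)"

fun total_disagreement_at :: "rule \<Rightarrow> nat \<Rightarrow> outcome \<Rightarrow> nat \<Rightarrow> bool" where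
  "total_disagreement_at \<delta> n ((c, c'), M) t \<longleftrightarrow>
     (\<forall>z \<in> cells n. evolve \<delta> n c M t z \<noteq> evolve \<delta> n c' M t z)"

definition coalescence :: "rule \<Rightarrow> (nat \<Rightarrow> config pmf) \<Rightarrow> nat \<Rightarrow> outcome set" where
  "coalescence \<delta> D n = {\<omega> \<in> space (coupling_space D n). \<exists>t. identical_at \<delta> n \<omega> t}"

definition total_disagreement :: "rule \<Rightarrow> (nat \<Rightarrow> config pmf) \<Rightarrow> nat \<Rightarrow> outcome set" where
  "total_disagreement \<delta> D n =
     {\<omega> \<in> space (coupling_space D n). \<exists>t\<^sub>0. \<forall>t \<ge> t\<^sub>0. total_disagreement_at \<delta> n \<omega> t}"

text \<open>The coalescence time is only meaningful on the event \<open>coalescence\<close>, so its expectation is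
  taken conditionally on that event.\<close>

definition coalescence_time :: "rule \<Rightarrow> nat \<Rightarrow> outcome \<Rightarrow> nat" where
  "coalescence_time \<delta> n \<omega> = (LEAST t. identical_at \<delta> n \<omega> t)"

definition expected_coalescence_time :: "rule \<Rightarrow> (nat \<Rightarrow> config pmf) \<Rightarrow> nat \<Rightarrow> ennreal" where
  "expected_coalescence_time \<delta> D n =
     (\<integral>\<^sup>+ \<omega>. of_nat (coalescence_time \<delta> n \<omega>)
        \<partial>uniform_measure (coupling_space D n) (coalescence \<delta> D n))"

end

theory Submission
  imports Defs
begin

text \<open>For both rules the pattern of disagreements between the two copies evolves by pure shifts: an
  updated cell takes over the disagreement bit of its right (rule 170) or left (rule 15) neighbour.
  The number \<open>N\<close> of disagreements is therefore a martingale, and given the current pattern \<open>N\<^sup>2\<close> grows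
  in expectation by at least a fixed \<open>v > 0\<close> as long as the pattern is not constant. As \<open>N\<^sup>2 \<le> n\<^sup>2\<close>,
  the expected number of steps with a non-constant pattern is at most \<open>n\<^sup>2 / v\<close>. Complementing the
  second initial configuration exchanges coalescence and total disagreement, so each of them has
  probability \<open>1/2\<close>.\<close>

section \<open>Rotations of the cell space and the two local rules\<close>

lemma finite_cells [simp]: "finite (cells n)"
  by (simp add: cells_def)

lemma bij_betw_rotate_cells: "bij_betw (\<lambda>z. (z + s) mod int n) (cells n) (cells n)"
proof (cases "n = 0")
  case True
  then show ?thesis by (simp add: cells_def bij_betw_def)
next
  case False
  have "inj_on (\<lambda>z. (z + s) mod int n) (cells n)"
  proof (rule inj_onI)
    fix x y assume xy: "x \<in> cells n" "y \<in> cells n" "(x + s) mod int n = (y + s) mod int n"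
    then have "(x + s - s) mod int n = (y + s - s) mod int n"
      by (intro mod_diff_cong refl)
    with xy show "x = y" by (auto simp: cells_def)
  qed
  moreover have "(\<lambda>z. (z + s) mod int n) ` cells n \<subseteq> cells n"
    using False by (auto simp: cells_def)
  ultimately show ?thesis
    by (simp add: bij_betw_def endo_inj_surj)
qed

text \<open>The binary digits of the code are the values of the rule: 170 = 10101010 has its ones
  exactly where the right neighbour is 1. In the same way 15 = 00001111 has its ones exactly where
  the left neighbour is 0.\<close>

lemma rule_170_eq:
  assumes "wolfram_code \<delta> = 170"
  shows "\<delta> = (\<lambda>l c r. r)"
proof (intro ext)
  fix l c r
  show "\<delta> l c r = r"
    using assms unfolding wolfram_code_def
    by (cases l; cases c; cases r) (auto simp: of_bool_def split: if_splits)
qed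

lemma rule_15_eq:
  assumes "wolfram_code \<delta> = 15"
  shows "\<delta> = (\<lambda>l c r. \<not> l)"
proof (intro ext)
  fix l c r
  show "\<delta> l c r = (\<not> l)"
    using assms unfolding wolfram_code_def
    by (cases l; cases c; cases r) (auto simp: of_bool_def split: if_splits)
qed

text \<open>The recursion of \<open>evolve\<close> consumes the last mask; peeling off the first one
  instead permits induction along the stream.\<close>

lemma evolve_SCons: "evolve \<delta> n c (m ## M) (Suc t) = evolve \<delta> n (step \<delta> n m c) M t"
  by (induction t) simp_all

section \<open>The pattern of disagreements\<close>

definition disagreements :: "nat \<Rightarrow> config \<Rightarrow> config \<Rightarrow> real" where
  "disagreements n c c' = (\<Sum>z\<in>cells n. of_bool (c z \<noteq> c' z))"

lemma disagreements_nonneg: "0 \<le> disagreements n c c'"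
  by (simp add: disagreements_def sum_nonneg)

lemma disagreements_le: "disagreements n c c' \<le> real n"
proof -
  have "disagreements n c c' \<le> (\<Sum>z\<in>cells n. 1)"
    unfolding disagreements_def by (intro sum_mono) auto
  then show ?thesis by (simp add: cells_def)
qed

text \<open>The transient pairs: neither coalesced nor in total disagreement.\<close>

definition partly_disagree :: "nat \<Rightarrow> config \<Rightarrow> config \<Rightarrow> bool" where
  "partly_disagree n c c' \<longleftrightarrow> (\<exists>z\<in>cells n. c z \<noteq> c' z) \<and> (\<exists>z\<in>cells n. c z = c' z)"

text \<open>Walk from cell 0 upwards. Below \<open>n\<close> no step wraps around; for
  \<open>s = -1\<close> the hypothesis is read at the upper of two adjacent cells.\<close>

lemma rotation_invariant_imp_constant:
  assumes "\<And>z. z \<in> cells n \<Longrightarrow> P ((z + s) mod int n) = P z" "s = 1 \<or> s = -1"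
    and "z \<in> cells n"
  shows "P z = P 0"
proof -
  have "P (int k) = P 0" if "k < n" for k
    using that
  proof (induction k)
    case (Suc k)
    have "P (int (Suc k)) = P (int k)"
    proof (cases "s = 1")
      case True
      have "(int k + s) mod int n = int (Suc k)" using True Suc.prems by simp
      with assms(1)[of "int k"] Suc.prems show ?thesis by (simp add: cells_def)
    next
      case False
      have "(int (Suc k) + s) mod int n = int k" using False assms(2) Suc.prems by simp
      with assms(1)[of "int (Suc k)"] Suc.prems show ?thesis by (simp add: cells_def)
    qed
    with Suc show ?case by simp
  qed simp
  from this[of "nat z"] assms(3) show ?thesis by (auto simp: cells_def)
qed

text \<open>Abstracts both dynamics at once: \<open>s\<close> points to the neighbour whose
  disagreement bit is copied, and \<open>b\<close>, \<open>v\<close> describe the second moments of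
  a mask. Taking \<open>z = w\<close> shows that every cell is updated with the same probability
  \<open>b + v\<close>.\<close>

locale shift_coupling =
  fixes \<delta> :: rule and s :: int and D :: "nat \<Rightarrow> config pmf" and n :: nat and b v :: real
  assumes size_pos: "n \<ge> 1"
    and shift_rule: "(s = 1 \<and> \<delta> = (\<lambda>l c r. r)) \<or> (s = -1 \<and> \<delta> = (\<lambda>l c r. \<not> l))"
    and v_pos: "v > 0"
    and mask_pair_prob: "\<And>z w. z \<in> cells n \<Longrightarrow> w \<in> cells n \<Longrightarrow>
      measure_pmf.prob (D n) {m. m z \<and> m w} = b + (if z = w then v else 0)"
begin

text \<open>The negation in rule 15 hits both copies and cancels in the comparison, so both rules
  shift disagreements.\<close>

lemma step_neq_iff:
  assumes "z \<in> cells n"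
  shows "(step \<delta> n m c z \<noteq> step \<delta> n m c' z) \<longleftrightarrow>
    (if m z then c ((z + s) mod int n) \<noteq> c' ((z + s) mod int n) else c z \<noteq> c' z)"
  using shift_rule assms by (elim disjE conjE) (auto simp: step_def)

text \<open>With \<open>\<delta>\<close> replaced by explicit Boolean operations, measurability of a
  step can be proved automatically.\<close>

lemma step_alt:
  "step \<delta> n m c z = (if z \<in> cells n \<and> m z
     then if s = 1 then c ((z + 1) mod int n) else \<not> c ((z - 1) mod int n) else c z)"
  using shift_rule by (elim disjE conjE) (simp_all add: step_def)

text \<open>The change of the disagreement bit at \<open>z\<close> caused by updating
  \<open>z\<close>.\<close>

definition gradient :: "config \<Rightarrow> config \<Rightarrow> int \<Rightarrow> real" where
  "gradient c c' z =
     of_bool (c ((z + s) mod int n) \<noteq> c' ((z + s) mod int n)) - of_bool (c z \<noteq> c' z)"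

text \<open>The sum telescopes around the cycle, since a rotation permutes the cells.\<close>

lemma sum_gradient: "(\<Sum>z\<in>cells n. gradient c c' z) = 0"
proof -
  have "(\<Sum>z\<in>cells n. of_bool (c ((z + s) mod int n) \<noteq> c' ((z + s) mod int n))) =
      (\<Sum>z\<in>cells n. of_bool (c z \<noteq> c' z) :: real)"
    by (rule sum.reindex_bij_betw[OF bij_betw_rotate_cells])
  then show ?thesis by (simp add: gradient_def sum_subtractf)
qed

text \<open>A gradient vanishing everywhere would make the pattern rotation invariant, hence
  constant. A nonzero gradient is 1 or -1, so one such cell contributes 1.\<close>

lemma sum_gradient_squared_ge:
  assumes "partly_disagree n c c'"
  shows "(\<Sum>z\<in>cells n. (gradient c c' z)\<^sup>2) \<ge> 1"
proof -
  have "\<exists>z\<in>cells n. gradient c c' z \<noteq> 0"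
  proof (rule ccontr)
    assume "\<not> ?thesis"
    then have zero: "gradient c c' z = 0" if "z \<in> cells n" for z using that by blast
    have inv: "(c ((z + s) mod int n) \<noteq> c' ((z + s) mod int n)) = (c z \<noteq> c' z)"
      if "z \<in> cells n" for z
      using zero[OF that] unfolding gradient_def by (simp add: of_bool_def split: if_splits)
    have "s = 1 \<or> s = -1" using shift_rule by auto
    then have "(c z \<noteq> c' z) = (c 0 \<noteq> c' 0)" if "z \<in> cells n" for z
      using rotation_invariant_imp_constant[of n "\<lambda>z. c z \<noteq> c' z" s z, OF inv _ that] by simp
    with assms show False unfolding partly_disagree_def by blast
  qed
  then obtain z where z: "z \<in> cells n" "gradient c c' z \<noteq> 0" by blast
  then have "1 \<le> (gradient c c' z)\<^sup>2"
    by (auto simp: gradient_def of_bool_def split: if_splits)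
  also have "\<dots> \<le> (\<Sum>z\<in>cells n. (gradient c c' z)\<^sup>2)"
    using z(1) by (intro member_le_sum) auto
  finally show ?thesis .
qed

lemma disagreements_step:
  "disagreements n (step \<delta> n m c) (step \<delta> n m c') =
     disagreements n c c' + (\<Sum>z\<in>cells n. gradient c c' z * of_bool (m z))"
  unfolding disagreements_def sum.distrib[symmetric]
  by (rule sum.cong) (simp_all only: step_neq_iff gradient_def, auto)

lemma
  assumes "z \<in> cells n" "w \<in> cells n"
  shows expectation_mask_pair: "measure_pmf.expectation (D n) (\<lambda>m. of_bool (m z) * of_bool (m w)) =
      b + (if z = w then v else 0)"
    and integrable_mask_pair:
      "integrable (measure_pmf (D n)) (\<lambda>m. of_bool (m z) * of_bool (m w) :: real)"
proof -
  have "(\<lambda>m. of_bool (m z) * of_bool (m w)) = (indicator {m. m z \<and> m w} :: config \<Rightarrow> real)"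
    by (auto simp: indicator_def fun_eq_iff)
  then show "measure_pmf.expectation (D n) (\<lambda>m. of_bool (m z) * of_bool (m w)) =
      b + (if z = w then v else 0)"
    using mask_pair_prob[OF assms] by simp
  show "integrable (measure_pmf (D n)) (\<lambda>m. of_bool (m z) * of_bool (m w) :: real)"
    by (rule measure_pmf.integrable_const_bound[where B = 1]) auto
qed

text \<open>Expand the square of \<open>N\<close> plus the sum of \<open>g z\<close> over updated
  cells. The linear term and the \<open>b\<close> part of the quadratic term contain the zero sum of
  the gradient; only the diagonal with weight \<open>v\<close> survives.\<close>

lemma expectation_disagreements_squared:
  "measure_pmf.expectation (D n)
      (\<lambda>m. (disagreements n (step \<delta> n m c) (step \<delta> n m c'))\<^sup>2) =
   (disagreements n c c')\<^sup>2 + v * (\<Sum>z\<in>cells n. (gradient c c' z)\<^sup>2)"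
proof -
  define N where "N = disagreements n c c'"
  define g where "g = gradient c c'"
  have sg: "(\<Sum>z\<in>cells n. g z) = 0" unfolding g_def by (rule sum_gradient)
  let ?X = "\<lambda>z w m. of_bool (m z) * of_bool (m w) :: real"
  let ?E = "measure_pmf.expectation (D n)"
  \<comment> \<open>The linear term also uses \<open>?X z z m\<close>, which equals the bit
    \<open>m z\<close>, so the pair expectations cover every term.\<close>
  have eq: "(disagreements n (step \<delta> n m c) (step \<delta> n m c'))\<^sup>2 =
      N\<^sup>2 + (\<Sum>z\<in>cells n. 2 * N * g z * ?X z z m)
       + (\<Sum>z\<in>cells n. \<Sum>w\<in>cells n. g z * g w * ?X z w m)" for m
  proof -
    have "(\<Sum>z\<in>cells n. 2 * N * g z * ?X z z m) = 2 * N * (\<Sum>z\<in>cells n. g z * of_bool (m z))"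
      unfolding sum_distrib_left by (rule sum.cong) auto
    moreover have "(\<Sum>z\<in>cells n. \<Sum>w\<in>cells n. g z * g w * ?X z w m) =
        (\<Sum>z\<in>cells n. g z * of_bool (m z))\<^sup>2"
      unfolding power2_eq_square sum_product by (intro sum.cong) auto
    ultimately show ?thesis
      by (simp add: disagreements_step N_def g_def power2_sum)
  qed
  have "?E (\<lambda>m. (disagreements n (step \<delta> n m c) (step \<delta> n m c'))\<^sup>2) =
      N\<^sup>2 + (\<Sum>z\<in>cells n. 2 * N * g z * ?E (?X z z))
       + (\<Sum>z\<in>cells n. \<Sum>w\<in>cells n. g z * g w * ?E (?X z w))"
    unfolding eq
    by (simp add: integrable_mask_pair Bochner_Integration.integral_add
        Bochner_Integration.integral_sum del: of_bool_conj)
  also have "(\<Sum>z\<in>cells n. 2 * N * g z * ?E (?X z z)) = (\<Sum>z\<in>cells n. 2 * N * (b + v) * g z)"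
    by (intro sum.cong) (simp_all only: expectation_mask_pair if_True refl mult_ac)
  also have "\<dots> = 0"
    by (simp add: sum_distrib_left[symmetric] sg)
  also have "(\<Sum>z\<in>cells n. \<Sum>w\<in>cells n. g z * g w * ?E (?X z w)) =
      (\<Sum>z\<in>cells n. \<Sum>w\<in>cells n. b * (g z * g w) + (if z = w then v * (g z)\<^sup>2 else 0))"
    by (intro sum.cong) (auto simp: expectation_mask_pair power2_eq_square algebra_simps)
  also have "\<dots> = b * ((\<Sum>z\<in>cells n. g z) * (\<Sum>z\<in>cells n. g z)) + v * (\<Sum>z\<in>cells n. (g z)\<^sup>2)"
  proof -
    have "(\<Sum>z\<in>cells n. \<Sum>w\<in>cells n. b * (g z * g w)) = b * ((\<Sum>z\<in>cells n. g z) * (\<Sum>z\<in>cells n. g z))"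
      unfolding sum_product by (simp only: sum_distrib_left)
    moreover have "(\<Sum>z\<in>cells n. \<Sum>w\<in>cells n. if z = w then v * (g z)\<^sup>2 else 0) =
        v * (\<Sum>z\<in>cells n. (g z)\<^sup>2)"
      by (simp add: sum_distrib_left)
    ultimately show ?thesis unfolding sum.distrib by simp
  qed
  finally show ?thesis by (simp add: sum_gradient N_def g_def)
qed

section \<open>Potential and time spent in transient pairs\<close>

text \<open>The room left for the growth of the squared number of disagreements, turned into a
  nonnegative quantity that decreases in expectation.\<close>

definition potential :: "config \<Rightarrow> config \<Rightarrow> real" where
  "potential c c' = (real n)\<^sup>2 - (disagreements n c c')\<^sup>2"

lemma potential_nonneg: "0 \<le> potential c c'"
  and potential_le: "potential c c' \<le> (real n)\<^sup>2"
  unfolding potential_def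
  using disagreements_nonneg disagreements_le by (auto intro!: power_mono)

text \<open>Combines the exact mean drift \<open>v * ?G\<close> with \<open>?G \<ge> 1\<close> on
  transient pairs. The additive form avoids truncated subtraction in \<open>ennreal\<close>.\<close>

lemma potential_decrease:
  "ennreal v * of_bool (partly_disagree n c c') +
     (\<integral>\<^sup>+ m. ennreal (potential (step \<delta> n m c) (step \<delta> n m c')) \<partial>measure_pmf (D n))
   \<le> ennreal (potential c c')"
proof -
  have int: "integrable (measure_pmf (D n))
      (\<lambda>m. (disagreements n (step \<delta> n m c) (step \<delta> n m c'))\<^sup>2)"
    by (rule measure_pmf.integrable_const_bound[where B = "(real n)\<^sup>2"])
       (auto intro!: power_mono disagreements_le disagreements_nonneg)
  let ?G = "\<Sum>z\<in>cells n. (gradient c c' z)\<^sup>2"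
  have mean: "measure_pmf.expectation (D n) (\<lambda>m. potential (step \<delta> n m c) (step \<delta> n m c')) =
      potential c c' - v * ?G"
    unfolding potential_def
    by (subst Bochner_Integration.integral_diff)
       (auto simp: int expectation_disagreements_squared)
  have "(\<integral>\<^sup>+ m. ennreal (potential (step \<delta> n m c) (step \<delta> n m c')) \<partial>measure_pmf (D n)) =
      ennreal (measure_pmf.expectation (D n) (\<lambda>m. potential (step \<delta> n m c) (step \<delta> n m c')))"
    by (rule nn_integral_eq_integral)
       (use int in \<open>auto simp: potential_nonneg\<close>, auto simp: potential_def)
  then have E: "(\<integral>\<^sup>+ m. ennreal (potential (step \<delta> n m c) (step \<delta> n m c')) \<partial>measure_pmf (D n)) =
      ennreal (potential c c' - v * ?G)"
    unfolding mean .
  \<comment> \<open>Being the mean of a nonnegative variable, this real number is not cut off at 0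
    by \<open>ennreal\<close>, so the two summands below recombine exactly.\<close>
  have "0 \<le> potential c c' - v * ?G"
    unfolding mean[symmetric] by (intro integral_nonneg_AE) (auto simp: potential_nonneg)
  moreover have "ennreal v * of_bool (partly_disagree n c c') \<le> ennreal (v * ?G)"
    using v_pos sum_gradient_squared_ge[of c c'] by (auto intro!: ennreal_leI)
  ultimately have "ennreal v * of_bool (partly_disagree n c c') + ennreal (potential c c' - v * ?G)
      \<le> ennreal (v * ?G) + ennreal (potential c c' - v * ?G)"
    by (intro add_mono) auto
  also have "\<dots> = ennreal (potential c c')"
    using v_pos \<open>0 \<le> potential c c' - v * ?G\<close>
    by (subst ennreal_plus[symmetric]) (auto intro!: sum_nonneg mult_nonneg_nonneg)
  finally show ?thesis unfolding E .
qed

text \<open>General \<open>C\<close> and \<open>M\<close> serve both fixed initial configurations on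
  the mask space and random ones on the coupling space. The induction needs all cells at once
  because a step reads a neighbour.\<close>

lemma measurable_evolve [measurable]:
  fixes C :: "'a \<Rightarrow> config" and M :: "'a \<Rightarrow> config stream"
  assumes [measurable]: "C \<in> A \<rightarrow>\<^sub>M count_space UNIV"
    and [measurable]: "M \<in> A \<rightarrow>\<^sub>M stream_space (measure_pmf (D n))"
  shows "Measurable.pred A (\<lambda>x. evolve \<delta> n (C x) (M x) t z)"
proof (induction t arbitrary: z)
  case 0
  have "Measurable.pred A (\<lambda>x. C x z)"
    by (rule measurable_compose[OF assms(1)]) simp
  then show ?case by simp
next
  case (Suc t)
  have [measurable]: "Measurable.pred A (\<lambda>x. (M x !! t) z)"
  proof -
    have "(\<lambda>x. M x !! t) \<in> A \<rightarrow>\<^sub>M measure_pmf (D n)" by measurable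
    then have "(\<lambda>x. M x !! t) \<in> A \<rightarrow>\<^sub>M count_space UNIV" by simp
    then show ?thesis by (rule measurable_compose) simp
  qed
  note [measurable] = Suc.IH
  show ?case unfolding evolve.simps step_alt by measurable
qed

abbreviation "mask_space \<equiv> stream_space (measure_pmf (D n))"

sublocale masks: prob_space mask_space
  by (rule prob_space.prob_space_stream_space[OF prob_space_measure_pmf])

lemma measurable_partly_disagree_evolve [measurable]:
  assumes [measurable]: "C \<in> A \<rightarrow>\<^sub>M count_space UNIV" "C' \<in> A \<rightarrow>\<^sub>M count_space UNIV"
    and [measurable]: "M \<in> A \<rightarrow>\<^sub>M mask_space"
  shows "Measurable.pred A
    (\<lambda>x. partly_disagree n (evolve \<delta> n (C x) (M x) t) (evolve \<delta> n (C' x) (M x) t))"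
  unfolding partly_disagree_def by measurable

text \<open>Induction on the horizon, with the first mask split off: the induction hypothesis bounds
  the remaining time by the potential after one step, and \<open>potential_decrease\<close> pays for
  time 0.\<close>

lemma occupation_bound:
  "ennreal v * (\<integral>\<^sup>+ M. (\<Sum>t<T. of_bool (partly_disagree n (evolve \<delta> n c M t) (evolve \<delta> n c' M t)))
      \<partial>mask_space) \<le> ennreal (potential c c')"
proof (induction T arbitrary: c c')
  case 0
  show ?case by simp
next
  case (Suc T)
  let ?a = "\<lambda>c c' M t. of_bool (partly_disagree n (evolve \<delta> n c M t) (evolve \<delta> n c' M t)) :: ennreal"
  have "(\<integral>\<^sup>+ M. (\<Sum>t<Suc T. ?a c c' M t) \<partial>mask_space) =
      (\<integral>\<^sup>+ m. (\<integral>\<^sup>+ M. (\<Sum>t<Suc T. ?a c c' (m ## M) t) \<partial>mask_space) \<partial>measure_pmf (D n))"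
    by (rule prob_space.nn_integral_stream_space[OF prob_space_measure_pmf]) measurable
  also have "\<dots> = (\<integral>\<^sup>+ m. (\<integral>\<^sup>+ M. of_bool (partly_disagree n c c') +
      (\<Sum>t<T. ?a (step \<delta> n m c) (step \<delta> n m c') M t) \<partial>mask_space) \<partial>measure_pmf (D n))"
    by (simp only: sum.lessThan_Suc_shift evolve_SCons evolve.simps(1))
  also have "\<dots> = of_bool (partly_disagree n c c') + (\<integral>\<^sup>+ m. (\<integral>\<^sup>+ M.
      (\<Sum>t<T. ?a (step \<delta> n m c) (step \<delta> n m c') M t) \<partial>mask_space) \<partial>measure_pmf (D n))"
    by (simp add: nn_integral_add masks.emeasure_space_1 measure_pmf.emeasure_space_1)
  finally have "ennreal v * (\<integral>\<^sup>+ M. (\<Sum>t<Suc T. ?a c c' M t) \<partial>mask_space) =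
      ennreal v * of_bool (partly_disagree n c c') + (\<integral>\<^sup>+ m. ennreal v * (\<integral>\<^sup>+ M.
      (\<Sum>t<T. ?a (step \<delta> n m c) (step \<delta> n m c') M t) \<partial>mask_space) \<partial>measure_pmf (D n))"
    by (simp add: distrib_left nn_integral_cmult)
  also have "\<dots> \<le> ennreal v * of_bool (partly_disagree n c c') +
      (\<integral>\<^sup>+ m. ennreal (potential (step \<delta> n m c) (step \<delta> n m c')) \<partial>measure_pmf (D n))"
    by (intro add_mono nn_integral_mono Suc.IH) simp
  also have "\<dots> \<le> ennreal (potential c c')" by (rule potential_decrease)
  finally show ?case .
qed

text \<open>The bound for a finite horizon does not depend on \<open>T\<close>, so it passes to the
  supremum.\<close>

lemma occupation_suminf_bound:
  "(\<integral>\<^sup>+ M. (\<Sum>t. of_bool (partly_disagree n (evolve \<delta> n c M t) (evolve \<delta> n c' M t)))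
      \<partial>mask_space) \<le> ennreal ((real n)\<^sup>2 / v)"
proof -
  let ?a = "\<lambda>t M. of_bool (partly_disagree n (evolve \<delta> n c M t) (evolve \<delta> n c' M t)) :: ennreal"
  have fin: "(\<Sum>t<T. \<integral>\<^sup>+ M. ?a t M \<partial>mask_space) \<le> ennreal ((real n)\<^sup>2 / v)" for T
  proof -
    have sum_eq: "(\<Sum>t<T. \<integral>\<^sup>+ M. ?a t M \<partial>mask_space) = (\<integral>\<^sup>+ M. (\<Sum>t<T. ?a t M) \<partial>mask_space)"
      by (rule nn_integral_sum[symmetric]) measurable
    have "ennreal v * (\<Sum>t<T. \<integral>\<^sup>+ M. ?a t M \<partial>mask_space) \<le> ennreal ((real n)\<^sup>2)"
      using order_trans[OF occupation_bound[where T = T] ennreal_leI[OF potential_le]]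
      unfolding sum_eq .
    then have "ennreal (1 / v) * (ennreal v * (\<Sum>t<T. \<integral>\<^sup>+ M. ?a t M \<partial>mask_space))
        \<le> ennreal (1 / v) * ennreal ((real n)\<^sup>2)"
      by (rule mult_left_mono) simp
    then show ?thesis
      using v_pos by (simp add: mult.assoc[symmetric] ennreal_mult[symmetric])
  qed
  have "(\<integral>\<^sup>+ M. (\<Sum>t. ?a t M) \<partial>mask_space) = (\<Sum>t. \<integral>\<^sup>+ M. ?a t M \<partial>mask_space)"
    by (rule nn_integral_suminf) measurable
  also have "\<dots> \<le> ennreal ((real n)\<^sup>2 / v)"
    unfolding suminf_eq_SUP by (rule SUP_least) (rule fin)
  finally show ?thesis .
qed


section \<open>Absorption on the coupling space\<close>

sublocale coupling: prob_space "coupling_space D n"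
  unfolding coupling_space_def
  by (intro prob_space_pair prob_space_measure_pmf masks.prob_space_axioms)

lemma measurable_coupling [measurable]:
  shows "(\<lambda>\<omega>. fst (fst \<omega>)) \<in> coupling_space D n \<rightarrow>\<^sub>M count_space UNIV"
    and "(\<lambda>\<omega>. snd (fst \<omega>)) \<in> coupling_space D n \<rightarrow>\<^sub>M count_space UNIV"
    and "snd \<in> coupling_space D n \<rightarrow>\<^sub>M mask_space"
proof -
  have "fst \<in> coupling_space D n \<rightarrow>\<^sub>M measure_pmf (pair_pmf (uniform_config n) (uniform_config n))"
    unfolding coupling_space_def by measurable
  then have "fst \<in> coupling_space D n \<rightarrow>\<^sub>M count_space UNIV" by simp
  from measurable_compose[OF this, of fst] measurable_compose[OF this, of snd]
  show "(\<lambda>\<omega>. fst (fst \<omega>)) \<in> coupling_space D n \<rightarrow>\<^sub>M count_space UNIV"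
    and "(\<lambda>\<omega>. snd (fst \<omega>)) \<in> coupling_space D n \<rightarrow>\<^sub>M count_space UNIV"
    by simp_all
  show "snd \<in> coupling_space D n \<rightarrow>\<^sub>M mask_space"
    unfolding coupling_space_def by measurable
qed

text \<open>Projections instead of pattern matching on the outcome, as the measurability rules
  require.\<close>

lemma identical_at_alt: "identical_at \<delta> n \<omega> t \<longleftrightarrow> (\<forall>z\<in>cells n.
    evolve \<delta> n (fst (fst \<omega>)) (snd \<omega>) t z = evolve \<delta> n (snd (fst \<omega>)) (snd \<omega>) t z)"
  and total_disagreement_at_alt: "total_disagreement_at \<delta> n \<omega> t \<longleftrightarrow> (\<forall>z\<in>cells n.
    evolve \<delta> n (fst (fst \<omega>)) (snd \<omega>) t z \<noteq> evolve \<delta> n (snd (fst \<omega>)) (snd \<omega>) t z)"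
  by (cases \<omega>; cases "fst \<omega>"; simp)+

lemma measurable_identical_at [measurable]:
  "Measurable.pred (coupling_space D n) (\<lambda>\<omega>. identical_at \<delta> n \<omega> t)"
  unfolding identical_at_alt by measurable

lemma measurable_total_disagreement_at [measurable]:
  "Measurable.pred (coupling_space D n) (\<lambda>\<omega>. total_disagreement_at \<delta> n \<omega> t)"
  unfolding total_disagreement_at_alt by measurable

lemma sets_coalescence [measurable]: "coalescence \<delta> D n \<in> sets (coupling_space D n)"
  unfolding coalescence_def by measurable

lemma sets_total_disagreement [measurable]:
  "total_disagreement \<delta> D n \<in> sets (coupling_space D n)"
  unfolding total_disagreement_def by measurable

lemma rotate_in_cells: "(z + s) mod int n \<in> cells n"
  using size_pos by (simp add: cells_def)

text \<open>Absorbing: every new disagreement bit is copied from an old one, and all of those are 0.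
  The lemma on total disagreement below is the same with all bits 1.\<close>

lemma identical_at_mono:
  assumes "identical_at \<delta> n \<omega> t" "t \<le> t'"
  shows "identical_at \<delta> n \<omega> t'"
  using assms(2,1)
proof (induction rule: dec_induct)
  case (step k)
  show ?case unfolding identical_at_alt evolve.simps
  proof
    fix z assume z: "z \<in> cells n"
    show "Defs.step \<delta> n (snd \<omega> !! k) (evolve \<delta> n (fst (fst \<omega>)) (snd \<omega>) k) z =
        Defs.step \<delta> n (snd \<omega> !! k) (evolve \<delta> n (snd (fst \<omega>)) (snd \<omega>) k) z"
      using step_neq_iff[OF z, of "snd \<omega> !! k" "evolve \<delta> n (fst (fst \<omega>)) (snd \<omega>) k"
          "evolve \<delta> n (snd (fst \<omega>)) (snd \<omega>) k"]
        step.IH[OF step.prems, unfolded identical_at_alt] z rotate_in_cells[of z]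
      by (cases "(snd \<omega> !! k) z") simp_all
  qed
qed

lemma total_disagreement_at_mono:
  assumes "total_disagreement_at \<delta> n \<omega> t" "t \<le> t'"
  shows "total_disagreement_at \<delta> n \<omega> t'"
  using assms(2,1)
proof (induction rule: dec_induct)
  case (step k)
  show ?case unfolding total_disagreement_at_alt evolve.simps
  proof
    fix z assume z: "z \<in> cells n"
    show "Defs.step \<delta> n (snd \<omega> !! k) (evolve \<delta> n (fst (fst \<omega>)) (snd \<omega>) k) z \<noteq>
        Defs.step \<delta> n (snd \<omega> !! k) (evolve \<delta> n (snd (fst \<omega>)) (snd \<omega>) k) z"
      using step_neq_iff[OF z, of "snd \<omega> !! k" "evolve \<delta> n (fst (fst \<omega>)) (snd \<omega>) k"
          "evolve \<delta> n (snd (fst \<omega>)) (snd \<omega>) k"]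
        step.IH[OF step.prems, unfolded total_disagreement_at_alt] z rotate_in_cells[of z]
      by (cases "(snd \<omega> !! k) z") simp_all
  qed
qed

text \<open>Absorption carries both events to a common later time, where they clash at cell
  0.\<close>

lemma not_identical_and_total_disagreement:
  "\<not> (identical_at \<delta> n \<omega> t \<and> total_disagreement_at \<delta> n \<omega> t')"
proof
  assume "identical_at \<delta> n \<omega> t \<and> total_disagreement_at \<delta> n \<omega> t'"
  then have "identical_at \<delta> n \<omega> (max t t')" "total_disagreement_at \<delta> n \<omega> (max t t')"
    using identical_at_mono total_disagreement_at_mono by (meson max.cobounded1 max.cobounded2)+
  moreover have "0 \<in> cells n" using size_pos by (simp add: cells_def)
  ultimately show False unfolding identical_at_alt total_disagreement_at_alt by blast
qed

lemma total_disagreement_alt: "total_disagreement \<delta> D n =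
    {\<omega> \<in> space (coupling_space D n). \<exists>t. total_disagreement_at \<delta> n \<omega> t}"
  unfolding total_disagreement_def using total_disagreement_at_mono by blast

text \<open>The time of absorption as a series in \<open>ennreal\<close>; its value is infinite if
  absorption never happens.\<close>

definition occupation_time :: "outcome \<Rightarrow> ennreal" where
  "occupation_time \<omega> =
     (\<Sum>t. of_bool (\<not> identical_at \<delta> n \<omega> t \<and> \<not> total_disagreement_at \<delta> n \<omega> t))"

lemma measurable_occupation_time [measurable]:
  "occupation_time \<in> borel_measurable (coupling_space D n)"
  unfolding occupation_time_def by measurable

text \<open>The bound for fixed initial configurations is uniform, so it survives averaging over
  them.\<close>

lemma expected_occupation_time:
  "(\<integral>\<^sup>+ \<omega>. occupation_time \<omega> \<partial>coupling_space D n) \<le> ennreal ((real n)\<^sup>2 / v)"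
proof -
  let ?P = "measure_pmf (pair_pmf (uniform_config n) (uniform_config n))"
  have "(\<integral>\<^sup>+ \<omega>. occupation_time \<omega> \<partial>coupling_space D n) =
      (\<integral>\<^sup>+ p. \<integral>\<^sup>+ M. occupation_time (p, M) \<partial>mask_space \<partial>?P)"
    unfolding coupling_space_def
    by (rule masks.nn_integral_fst[symmetric])
       (rule measurable_occupation_time[unfolded coupling_space_def])
  also have "\<dots> \<le> (\<integral>\<^sup>+ p. ennreal ((real n)\<^sup>2 / v) \<partial>?P)"
  proof (rule nn_integral_mono)
    fix p
    have "occupation_time (p, M) =
        (\<Sum>t. of_bool (partly_disagree n (evolve \<delta> n (fst p) M t) (evolve \<delta> n (snd p) M t)))" for M
      unfolding occupation_time_def identical_at_alt total_disagreement_at_alt partly_disagree_def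
      by simp
    then show "(\<integral>\<^sup>+ M. occupation_time (p, M) \<partial>mask_space) \<le> ennreal ((real n)\<^sup>2 / v)"
      using occupation_suminf_bound by simp
  qed
  also have "\<dots> = ennreal ((real n)\<^sup>2 / v)"
    by (simp add: measure_pmf.emeasure_space_1)
  finally show ?thesis .
qed

lemma le_occupation_time:
  assumes "\<And>t. t < T \<Longrightarrow> \<not> identical_at \<delta> n \<omega> t \<and> \<not> total_disagreement_at \<delta> n \<omega> t"
  shows "of_nat T \<le> occupation_time \<omega>"
proof -
  have "of_nat T = (\<Sum>t<T. of_bool (\<not> identical_at \<delta> n \<omega> t \<and> \<not> total_disagreement_at \<delta> n \<omega> t) :: ennreal)"
    using assms by simp
  also have "\<dots> \<le> occupation_time \<omega>"
    unfolding occupation_time_def by (rule sum_le_suminf) auto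
  finally show ?thesis .
qed

text \<open>A finite expectation makes the occupation time almost surely finite. If it is below
  \<open>T\<close>, some time before \<open>T\<close> is not transient.\<close>

lemma AE_absorbed:
  "AE \<omega> in coupling_space D n. \<omega> \<in> coalescence \<delta> D n \<union> total_disagreement \<delta> D n"
proof -
  have "(\<integral>\<^sup>+ \<omega>. occupation_time \<omega> \<partial>coupling_space D n) \<noteq> \<infinity>"
    using expected_occupation_time by (auto simp: top_unique)
  then have "AE \<omega> in coupling_space D n. occupation_time \<omega> \<noteq> \<infinity>"
    by (rule nn_integral_noteq_infinite[OF measurable_occupation_time])
  then show ?thesis
  proof (rule AE_mp, intro AE_I2 impI)
    fix \<omega> assume \<omega>: "\<omega> \<in> space (coupling_space D n)" "occupation_time \<omega> \<noteq> \<infinity>"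
    then obtain T :: nat where "occupation_time \<omega> < of_nat T"
      using ennreal_Ex_less_of_nat[of "occupation_time \<omega>"] by (auto simp: less_top)
    then have "\<not> of_nat T \<le> occupation_time \<omega>" by simp
    then obtain t where "identical_at \<delta> n \<omega> t \<or> total_disagreement_at \<delta> n \<omega> t"
      using le_occupation_time[of T \<omega>] by blast
    with \<omega> show "\<omega> \<in> coalescence \<delta> D n \<union> total_disagreement \<delta> D n"
      unfolding coalescence_def total_disagreement_alt by blast
  qed
qed

section \<open>The symmetry between the two outcomes\<close>

text \<open>Values outside \<open>cells n\<close> are kept, so that the support of
  \<open>uniform_config n\<close> is preserved.\<close>

definition complement :: "config \<Rightarrow> config" where
  "complement c = (\<lambda>z. if z \<in> cells n then \<not> c z else c z)"

text \<open>Both rules are self-dual: negating all inputs negates the output.\<close>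

lemma evolve_complement:
  "z \<in> cells n \<Longrightarrow> evolve \<delta> n (complement c) M t z = (\<not> evolve \<delta> n c M t z)"
proof (induction t arbitrary: z)
  case 0
  then show ?case by (simp add: complement_def)
next
  case (Suc t)
  \<comment> \<open>The neighbours read by a step are again cells, so the induction hypothesis
    applies to them.\<close>
  have "(y mod int n) \<in> cells n" for y using size_pos by (simp add: cells_def)
  with Suc show ?case using shift_rule by (elim disjE conjE) (simp_all add: step_def)
qed

text \<open>Complementation is an involution of the finite set on which the law is uniform.\<close>

lemma map_complement_uniform_config: "map_pmf complement (uniform_config n) = uniform_config n"
proof -
  let ?C = "{c :: config. \<forall>z. z \<notin> cells n \<longrightarrow> \<not> c z}"
  have inv: "complement (complement c) = c" for c by (auto simp: complement_def fun_eq_iff)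
  have "complement c \<in> ?C" if "c \<in> ?C" for c using that by (auto simp: complement_def)
  then have "bij_betw complement ?C ?C"
    using inv by (intro bij_betwI[where g = complement]) auto
  moreover have "?C \<subseteq> (\<lambda>X z. z \<in> X) ` Pow (cells n)"
  proof
    fix c assume "c \<in> ?C"
    then have "c = (\<lambda>z. z \<in> {z. c z})" "{z. c z} \<in> Pow (cells n)" by auto
    then show "c \<in> (\<lambda>X z. z \<in> X) ` Pow (cells n)" by (rule image_eqI)
  qed
  then have "finite ?C" by (rule finite_subset) simp
  moreover have "(\<lambda>_. False) \<in> ?C" by simp
  ultimately show ?thesis
    unfolding uniform_config_def by (intro map_pmf_of_set_bij_betw) blast+
qed

definition complement_second :: "outcome \<Rightarrow> outcome" where
  "complement_second = (\<lambda>(p, M). (apsnd complement p, M))"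

text \<open>The second configuration is uniform and independent of the first one and of the masks,
  so complementing it leaves the joint law unchanged.\<close>

lemma coupling_space_complement_invariant:
  "coupling_space D n =
     distr (coupling_space D n) (count_space UNIV \<Otimes>\<^sub>M mask_space) complement_second"
proof -
  let ?P = "pair_pmf (uniform_config n) (uniform_config n)"
  have "map_pmf (apsnd complement) ?P = ?P"
    by (simp add: pair_map_pmf2[symmetric] map_complement_uniform_config)
  then have "measure_pmf ?P = distr (measure_pmf ?P) (count_space UNIV) (apsnd complement)"
    by (metis map_pmf_rep_eq)
  \<comment> \<open>The mask factor is written as its own image under the identity to fit
    \<open>pair_measure_distr\<close>.\<close>
  then have "coupling_space D n =
      distr (measure_pmf ?P) (count_space UNIV) (apsnd complement) \<Otimes>\<^sub>M
      distr mask_space mask_space (\<lambda>M. M)"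
    unfolding coupling_space_def by simp
  also have "\<dots> = distr (coupling_space D n) (count_space UNIV \<Otimes>\<^sub>M mask_space) complement_second"
    unfolding coupling_space_def complement_second_def
    by (rule pair_measure_distr) (simp_all add: masks.sigma_finite_measure_axioms)
  finally show ?thesis .
qed

lemma measurable_complement_second [measurable]:
  "complement_second \<in> coupling_space D n \<rightarrow>\<^sub>M (count_space UNIV \<Otimes>\<^sub>M mask_space)"
proof -
  have "fst \<in> coupling_space D n \<rightarrow>\<^sub>M measure_pmf (pair_pmf (uniform_config n) (uniform_config n))"
    unfolding coupling_space_def by measurable
  then have "fst \<in> coupling_space D n \<rightarrow>\<^sub>M count_space UNIV" by simp
  then have [measurable]: "(\<lambda>\<omega>. apsnd complement (fst \<omega>)) \<in> coupling_space D n \<rightarrow>\<^sub>M count_space UNIV"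
    by (rule measurable_compose) simp
  show ?thesis unfolding complement_second_def split_beta by measurable
qed

text \<open>Coalescence is the preimage of total disagreement under a map that preserves the
  law.\<close>

lemma measure_coalescence_eq_total_disagreement:
  "measure (coupling_space D n) (coalescence \<delta> D n) =
   measure (coupling_space D n) (total_disagreement \<delta> D n)"
proof -
  have swap: "total_disagreement_at \<delta> n (complement_second \<omega>) t \<longleftrightarrow> identical_at \<delta> n \<omega> t" for \<omega> t
    unfolding total_disagreement_at_alt identical_at_alt complement_second_def
    by (simp add: split_beta evolve_complement)
  have sp: "space (coupling_space D n) = UNIV"
    by (simp add: coupling_space_def space_pair_measure space_stream_space)
  have "measure (coupling_space D n) (total_disagreement \<delta> D n) =
      measure (distr (coupling_space D n) (count_space UNIV \<Otimes>\<^sub>M mask_space) complement_second)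
        (total_disagreement \<delta> D n)"
    using coupling_space_complement_invariant by simp
  also have "\<dots> = measure (coupling_space D n)
      (complement_second -` total_disagreement \<delta> D n \<inter> space (coupling_space D n))"
  proof (rule measure_distr[OF measurable_complement_second])
    have "sets (coupling_space D n) = sets (count_space UNIV \<Otimes>\<^sub>M mask_space)"
      unfolding coupling_space_def by (intro sets_pair_measure_cong) simp_all
    then show "total_disagreement \<delta> D n \<in> sets (count_space UNIV \<Otimes>\<^sub>M mask_space)"
      using sets_total_disagreement by simp
  qed
  also have "complement_second -` total_disagreement \<delta> D n \<inter> space (coupling_space D n) =
      coalescence \<delta> D n"
    unfolding total_disagreement_alt coalescence_def by (auto simp: swap sp)
  finally show ?thesis by simp
qed

text \<open>Two disjoint events of equal probability that together have probability 1.\<close>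

lemma measure_coalescence: "measure (coupling_space D n) (coalescence \<delta> D n) = 1 / 2"
  and measure_total_disagreement:
    "measure (coupling_space D n) (total_disagreement \<delta> D n) = 1 / 2"
proof -
  have "coupling.prob (coalescence \<delta> D n \<union> total_disagreement \<delta> D n) = 1"
    using AE_absorbed by (intro coupling.prob_eq_1[THEN iffD2]) auto
  moreover have "coalescence \<delta> D n \<inter> total_disagreement \<delta> D n = {}"
    unfolding total_disagreement_alt coalescence_def
    using not_identical_and_total_disagreement by blast
  ultimately have "coupling.prob (coalescence \<delta> D n) + coupling.prob (total_disagreement \<delta> D n) = 1"
    by (simp add: coupling.finite_measure_Union)
  with measure_coalescence_eq_total_disagreement
  show "measure (coupling_space D n) (coalescence \<delta> D n) = 1 / 2"
    and "measure (coupling_space D n) (total_disagreement \<delta> D n) = 1 / 2"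
    by simp_all
qed

text \<open>On coalescence the pair never disagrees totally, so every step before the coalescence
  time is transient. The factor 2 comes from conditioning on an event of probability 1/2.\<close>

lemma expected_coalescence_time_le:
  "expected_coalescence_time \<delta> D n \<le> ennreal (2 * (real n)\<^sup>2 / v)"
proof -
  have le: "of_nat (coalescence_time \<delta> n \<omega>) \<le> occupation_time \<omega>" if "\<omega> \<in> coalescence \<delta> D n" for \<omega>
  proof (rule le_occupation_time)
    fix t assume "t < coalescence_time \<delta> n \<omega>"
    then have "\<not> identical_at \<delta> n \<omega> t"
      unfolding coalescence_time_def by (rule not_less_Least)
    with that show "\<not> identical_at \<delta> n \<omega> t \<and> \<not> total_disagreement_at \<delta> n \<omega> t"
      using not_identical_and_total_disagreement unfolding coalescence_def by blast
  qed
  have [measurable]: "(\<lambda>\<omega>. of_nat (coalescence_time \<delta> n \<omega>) :: ennreal)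
      \<in> borel_measurable (coupling_space D n)"
    unfolding coalescence_time_def by measurable
  have "expected_coalescence_time \<delta> D n =
      (\<integral>\<^sup>+ \<omega>. of_nat (coalescence_time \<delta> n \<omega>) * indicator (coalescence \<delta> D n) \<omega>
        \<partial>coupling_space D n) / ennreal (1 / 2)"
    unfolding expected_coalescence_time_def
    by (subst nn_integral_uniform_measure)
       (simp_all add: coupling.emeasure_eq_measure measure_coalescence)
  also have "\<dots> \<le> ennreal ((real n)\<^sup>2 / v) / ennreal (1 / 2)"
  proof (rule divide_right_mono_ennreal)
    have "(\<integral>\<^sup>+ \<omega>. of_nat (coalescence_time \<delta> n \<omega>) * indicator (coalescence \<delta> D n) \<omega>
        \<partial>coupling_space D n) \<le> (\<integral>\<^sup>+ \<omega>. occupation_time \<omega> \<partial>coupling_space D n)"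
      by (intro nn_integral_mono) (auto simp: indicator_def le)
    then show "(\<integral>\<^sup>+ \<omega>. of_nat (coalescence_time \<delta> n \<omega>) * indicator (coalescence \<delta> D n) \<omega>
        \<partial>coupling_space D n) \<le> ennreal ((real n)\<^sup>2 / v)"
      using expected_occupation_time by (rule order_trans)
  qed
  also have "\<dots> = ennreal (2 * (real n)\<^sup>2 / v)"
    using v_pos by (subst divide_ennreal) simp_all
  finally show ?thesis .
qed

end

section \<open>Second moments of the masks in the two dynamics\<close>

lemma prob_pair_partially_asynchronous:
  assumes "0 \<le> \<alpha>" "\<alpha> \<le> 1" "z \<in> cells n" "w \<in> cells n"
  shows "measure_pmf.prob (partially_asynchronous \<alpha> n) {m. m z \<and> m w} =
    \<alpha>\<^sup>2 + (if z = w then \<alpha> * (1 - \<alpha>) else 0)"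
proof -
  \<comment> \<open>Written as a product set, the event has one factor \<alpha> for each distinct
    cell among \<open>z\<close> and \<open>w\<close>; for \<open>z = w\<close> the single factor
    splits as \<open>\<alpha>\<^sup>2 + \<alpha> * (1 - \<alpha>)\<close>.\<close>
  let ?B = "\<lambda>x. if x \<in> {z, w} then {True} else UNIV"
  have "{m. m z \<and> m w} = Pi (cells n) ?B"
    using assms(3,4) by (auto simp: Pi_def)
  then have "measure_pmf.prob (partially_asynchronous \<alpha> n) {m. m z \<and> m w} =
      (\<Prod>x\<in>cells n. measure_pmf.prob (bernoulli_pmf \<alpha>) (?B x))"
    unfolding partially_asynchronous_def by (simp only: measure_Pi_pmf_Pi finite_cells)
  also have "\<dots> = (\<Prod>x\<in>{z, w}. measure_pmf.prob (bernoulli_pmf \<alpha>) (?B x))"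
    using assms(3,4) by (intro prod.mono_neutral_right) auto
  also have "\<dots> = \<alpha>\<^sup>2 + (if z = w then \<alpha> * (1 - \<alpha>) else 0)"
    using assms(1,2) by (auto simp: measure_pmf_single power2_eq_square algebra_simps)
  finally show ?thesis .
qed

text \<open>Two distinct cells are never updated together, so \<open>b = 0\<close>; the explicit
  summand 0 matches the form of \<open>mask_pair_prob\<close>.\<close>

lemma prob_pair_fully_asynchronous:
  assumes "z \<in> cells n" "w \<in> cells n"
  shows "measure_pmf.prob (fully_asynchronous n) {m. m z \<and> m w} =
    0 + (if z = w then 1 / real n else 0)"
proof -
  have ne: "cells n \<noteq> {}" using assms by auto
  have "cells n \<inter> (\<lambda>z z'. z' = z) -` {m. m z \<and> m w} = (if z = w then {z} else {})"
    using assms by auto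
  moreover have "card (cells n) = n" by (simp add: cells_def)
  ultimately show ?thesis
    unfolding fully_asynchronous_def by (simp add: measure_pmf_of_set ne)
qed

text \<open>Rounding the real coefficient up gives a polynomial with natural coefficients, chosen
  independently of \<open>n\<close>.\<close>

lemma ennreal_cubic_le_poly:
  fixes \<kappa> :: real
  assumes "\<kappa> > 0"
  shows "\<exists>p :: nat poly. \<forall>n. ennreal (2 * real n ^ 3 / \<kappa>) \<le> of_nat (poly p n)"
proof (intro exI allI)
  fix n
  define K where "K = nat \<lceil>2 / \<kappa>\<rceil>"
  have "2 / \<kappa> \<le> real K" unfolding K_def by linarith
  then have "2 / \<kappa> * real n ^ 3 \<le> real K * real n ^ 3" by (rule mult_right_mono) simp
  then have "2 * real n ^ 3 / \<kappa> \<le> real (poly (monom K 3) n)"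
    by (simp add: poly_monom)
  then have "ennreal (2 * real n ^ 3 / \<kappa>) \<le> ennreal (real (poly (monom K 3) n))"
    by (rule ennreal_leI)
  then show "ennreal (2 * real n ^ 3 / \<kappa>) \<le> of_nat (poly (monom (nat \<lceil>2 / \<kappa>\<rceil>) 3) n)"
    by (simp add: ennreal_of_nat_eq_real_of_nat K_def)
qed

theorem mainTheorem4:
  fixes \<delta> :: rule and D :: "nat \<Rightarrow> config pmf"
  assumes "wolfram_code \<delta> = 15 \<or> wolfram_code \<delta> = 170"
    and "(\<exists>\<alpha>::real. 0 < \<alpha> \<and> \<alpha> < 1 \<and> D = partially_asynchronous \<alpha>) \<or> D = fully_asynchronous"
  shows "(\<forall>n\<ge>1. measure (coupling_space D n) (coalescence \<delta> D n) = 1 / 2 \<and>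
                measure (coupling_space D n) (total_disagreement \<delta> D n) = 1 / 2) \<and>
         (\<exists>p :: nat poly. \<forall>n\<ge>1. expected_coalescence_time \<delta> D n \<le> of_nat (poly p n))"
proof -
  obtain s :: int where rule: "(s = 1 \<and> \<delta> = (\<lambda>l c r. r)) \<or> (s = -1 \<and> \<delta> = (\<lambda>l c r. \<not> l))"
    using assms(1) rule_15_eq rule_170_eq by blast
  \<comment> \<open>A lower bound on \<open>v\<close> of order 1/n fits both dynamics and yields a
    common cubic time bound.\<close>
  have "\<exists>\<kappa>>0. \<forall>n\<ge>1. \<exists>b v. \<kappa> / real n \<le> v \<and> shift_coupling \<delta> s D n b v"
    using assms(2)
  proof (elim disjE exE conjE)
    fix \<alpha> :: real assume \<alpha>: "0 < \<alpha>" "\<alpha> < 1" "D = partially_asynchronous \<alpha>"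
    \<comment> \<open>Here \<open>\<alpha> < 1\<close> gives \<open>v > 0\<close>. At \<alpha> = 1
      the variance would vanish: a synchronous step only rotates the pattern, so a transient pair
      would stay transient.\<close>
    then have "shift_coupling \<delta> s D n (\<alpha>\<^sup>2) (\<alpha> * (1 - \<alpha>))" if "n \<ge> 1" for n
      using rule that by unfold_locales (auto simp: prob_pair_partially_asynchronous)
    moreover have "\<alpha> * (1 - \<alpha>) / real n \<le> \<alpha> * (1 - \<alpha>)" if "n \<ge> 1" for n
      using \<alpha> that by (auto simp: divide_le_eq mult_le_cancel_left1 mult_less_0_iff)
    ultimately show ?thesis
      using \<alpha> by (intro exI[of _ "\<alpha> * (1 - \<alpha>)"]) auto
  next
    assume "D = fully_asynchronous"
    then have "shift_coupling \<delta> s D n 0 (1 / real n)" if "n \<ge> 1" for n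
      using rule that by unfold_locales (auto simp: prob_pair_fully_asynchronous)
    then show ?thesis by (intro exI[of _ 1]) auto
  qed
  then obtain \<kappa> where \<kappa>: "\<kappa> > 0"
    and ex: "\<And>n. n \<ge> 1 \<Longrightarrow> \<exists>b v. \<kappa> / real n \<le> v \<and> shift_coupling \<delta> s D n b v"
    by blast
  have half: "measure (coupling_space D n) (coalescence \<delta> D n) = 1 / 2 \<and>
      measure (coupling_space D n) (total_disagreement \<delta> D n) = 1 / 2" if "n \<ge> 1" for n
    using ex[OF that] shift_coupling.measure_coalescence shift_coupling.measure_total_disagreement
    by blast
  have time: "expected_coalescence_time \<delta> D n \<le> ennreal (2 * real n ^ 3 / \<kappa>)" if "n \<ge> 1" for n
  proof -
    from ex[OF that] obtain b v where v: "\<kappa> / real n \<le> v" and "shift_coupling \<delta> s D n b v"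
      by blast
    then have "expected_coalescence_time \<delta> D n \<le> ennreal (2 * (real n)\<^sup>2 / v)"
      by (intro shift_coupling.expected_coalescence_time_le)
    \<comment> \<open>The third power of \<open>n\<close> arises from the factor 1/n in the lower
      bound on \<open>v\<close>.\<close>
    also have "2 * (real n)\<^sup>2 / v \<le> 2 * (real n)\<^sup>2 / (\<kappa> / real n)"
      using v \<kappa> that by (intro divide_left_mono mult_pos_pos) (auto intro: less_le_trans[OF _ v])
    also have "\<dots> = 2 * real n ^ 3 / \<kappa>"
      by (simp add: power2_eq_square power3_eq_cube)
    finally show ?thesis by (simp add: ennreal_leI)
  qed
  with half ennreal_cubic_le_poly[OF \<kappa>] show ?thesis by (meson order_trans)
qed

end
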